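(* We have $$\tilde{\mathfrak{S}}(213,312)^{\mathsf{des},\mathsf{iar},\mathsf{comp}}(t,r,p)=\frac{1-rz}{(1-rpz)(1-(r+t)z)},$$ $$\tilde{\mathfrak{S}}(231,312)^{\mathsf{des},\mathsf{iar},\mathsf{comp}}(t,r,p)=\frac{1-pz}{(1-rpz)(1-(p+t)z)},$$ $$\tilde{\mathfrak{S}}(231,321)^{\mathsf{des},\mathsf{iar},\mathsf{comp}}(t,r,p)=\frac{1-(1+p-t)z+(1-t)pz^2}{(1-rpz)(1-(p+1)z+(1-t)pz^2)}.$$
   Context: $\mathfrak{S}_n$ is the set of permutations $\pi=\pi(1)\cdots\pi(n)$ of $[n]=\{1,\dots,n\}$. A permutation $\pi\in\mathfrak{S}_n$ contains the pattern $\sigma\in\mathfrak{S}_k$ if there are $j_1<\cdots<j_k$ such that $\pi(j_a)<\pi(j_b)$ if and only if $\sigma(a)<\sigma(b)$ for all $1\le a<b\le k$; otherwise it avoids $\sigma$. For a set $P$ of patterns, $\mathfrak{S}_n(P)$ is the set of $\pi\in\mathfrak{S}_n$ avoiding every pattern in $P$. For $\pi\in\mathfrak{S}_n$: $\mathrm{DES}(\pi)=\{i\in[n-1]:\pi(i)>\pi(i+1)\}$, $\mathsf{des}(\pi)=|\mathrm{DES}(\pi)|$, $\mathsf{iar}(\pi)=\min(\mathrm{DES}(\pi)\cup\{n\})$, $\mathsf{comp}(\pi)=|\{i\in[n]:\pi(j)\le i\text{ for all }j\le i\}|$. Define the formal power series in $z$ $$\mathfrak{S}(P)^{\mathsf{des},\mathsf{iar},\mathsf{comp}}(t,r,p;z)=\sum_{n\ge0}z^n\sum_{\pi\in\mathfrak{S}_n(P)}t^{\mathsf{des}(\pi)}r^{\mathsf{iar}(\pi)}p^{\mathsf{comp}(\pi)},$$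 where the empty permutation ($n=0$) contributes $1$, and $\tilde{\mathfrak{S}}(P)^{\mathsf{des},\mathsf{iar},\mathsf{comp}}(t,r,p)=\big(\mathfrak{S}(P)^{\mathsf{des},\mathsf{iar},\mathsf{comp}}(t,r,p;z)-1\big)/(rpz)$. *)

theory Defs
  imports
    "HOL-Combinatorics.Multiset_Permutations"
    "HOL-Computational_Algebra.Formal_Power_Series"
begin

(* A permutation of [n] is its one-line word, an element of permutations_of_set {1..n}.
   Lists are indexed from 0, so pi(i) in the usual notation is w ! (i - 1). *)

definition contains_pattern :: "nat list \<Rightarrow> nat list \<Rightarrow> bool" where
  "contains_pattern w s \<longleftrightarrow>
     (\<exists>j :: nat \<Rightarrow> nat.
        strict_mono_on {..<length s} j \<and>
        (\<forall>a<length s. j a < length w) \<and>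
        (\<forall>a b. a < b \<and> b < length s \<longrightarrow> (w ! j a < w ! j b \<longleftrightarrow> s ! a < s ! b)))"

definition avoiders :: "nat list set \<Rightarrow> nat \<Rightarrow> nat list set" where
  "avoiders P n = {w \<in> permutations_of_set {1..n}. \<forall>s\<in>P. \<not> contains_pattern w s}"

(* Descent positions are numbered from 1, as in the usual convention. *)
definition DES :: "nat list \<Rightarrow> nat set" where
  "DES w = {i \<in> {1..<length w}. w ! (i - 1) > w ! i}"

definition des :: "nat list \<Rightarrow> nat" where
  "des w = card (DES w)"

definition iar :: "nat list \<Rightarrow> nat" where
  "iar w = Min (DES w \<union> {length w})"

definition comp :: "nat list \<Rightarrow> nat" where
  "comp w = card {i \<in> {1..length w}. \<forall>j\<in>{1..i}. w ! (j - 1) \<le> i}"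

definition perm_gf :: "nat list set \<Rightarrow> 'a \<Rightarrow> 'a \<Rightarrow> 'a \<Rightarrow> 'a :: comm_semiring_1 fps" where
  "perm_gf P t r p =
     Abs_fps (\<lambda>n. \<Sum>w\<in>avoiders P n. t ^ des w * r ^ iar w * p ^ comp w)"

(* Division of formal power series by a multiple of the variable. The dividend has constant
   term 0, so for nonzero r and p the quotient is exact. *)
definition perm_gf_tilde :: "nat list set \<Rightarrow> 'a \<Rightarrow> 'a \<Rightarrow> 'a \<Rightarrow> 'a :: field fps" where
  "perm_gf_tilde P t r p =
     (perm_gf P t r p - 1) / (fps_const r * fps_const p * fps_X)"

end

theory Submission
  imports Defs
begin

text \<open>
  In all three classes, a permutation of \<open>[n + 2]\<close> either starts with 1 or arises from a
  permutation of \<open>[n + 1]\<close> in the same class by one explicit insertion \<open>f\<close>. A permutation that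
  starts with 1 is \<open>1 \<oplus> w\<close> with \<open>w\<close> in the class, which preserves \<open>des\<close> and raises both \<open>iar\<close> and
  \<open>comp\<close> by one, so these permutations contribute \<open>r * p\<close> times the preceding coefficient and
  account for the factor \<open>1 - r p z\<close>. The insertion \<open>f\<close> depends on the class:

  \<^item> Avoiding 213 and 312 means having no valley, so 1 is at one of the two ends; \<open>f\<close> appends a new
    minimum. This adds a descent, keeps \<open>iar\<close>, and makes \<open>comp\<close> equal to 1.
  \<^item> Avoiding 231 and 312 means being layered, a direct sum of decreasing words; \<open>f\<close> lengthens the
    first layer by one. This adds a descent, keeps \<open>comp\<close>, and makes \<open>iar\<close> equal to 1.
  \<^item> Avoiding 231 and 321 means that no entry has two larger entries to its left, so 1 is in one of
    the first two positions; \<open>f\<close> inserts a new minimum in second position. This keeps \<open>comp\<close>, makes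
    \<open>iar\<close> equal to 1, and adds a descent exactly if the old word starts with 1.

  In the first two cases \<open>f\<close> makes one of \<open>iar\<close>, \<open>comp\<close> constant, so the weight of the image involves
  only the specialisation \<open>p = 1\<close> or \<open>r = 1\<close>. Reading the recursion at this specialisation gives a
  geometric sequence. In the third case it gives a linear recursion of order two. Thus in every case
  the words that do not start with 1 contribute \<open>r * t * p * e n\<close>, where the generating function
  of \<open>e\<close> is \<open>1 / D\<close> for the nontrivial factor \<open>D\<close> of the denominator. Hence the normalised series is
  \<open>(1 + t z / D) / (1 - r p z)\<close>, which is the claim; this last step is \<open>perm_gf_tilde_eq\<close>.
\<close>

section \<open>Avoiding two patterns of length three\<close>

text \<open>
  Each pair of patterns amounts to one forbidden relation between the values of three entries.
  Recursion on the word makes the effect of adding a first entry immediate: only the condition on the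
  remaining pairs is new.
\<close>

fun triple_free :: "(nat \<Rightarrow> nat \<Rightarrow> nat \<Rightarrow> bool) \<Rightarrow> nat list \<Rightarrow> bool" where
  "triple_free T [] \<longleftrightarrow> True"
| "triple_free T (x # xs) \<longleftrightarrow> sorted_wrt (\<lambda>y z. \<not> T x y z) xs \<and> triple_free T xs"

lemma triple_free_iff_nth:
  "triple_free T w \<longleftrightarrow>
     (\<forall>i j k. i < j \<and> j < k \<and> k < length w \<longrightarrow> \<not> T (w ! i) (w ! j) (w ! k))"
proof (induction w)
  case (Cons x w)
  have "(\<forall>i j k. i < j \<and> j < k \<and> k < length (x # w) \<longrightarrow> \<not> T ((x # w) ! i) ((x # w) ! j) ((x # w) ! k))
    \<longleftrightarrow> (\<forall>j k. j < k \<and> k < length w \<longrightarrow> \<not> T x (w ! j) (w ! k)) \<and>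
        (\<forall>i j k. i < j \<and> j < k \<and> k < length w \<longrightarrow> \<not> T (w ! i) (w ! j) (w ! k))"
    (is "?L \<longleftrightarrow> ?R")
  proof
    assume L: ?L
    show ?R
    proof (intro conjI allI impI)
      fix j k assume "j < k \<and> k < length w"
      then show "\<not> T x (w ! j) (w ! k)" using L[rule_format, of 0 "Suc j" "Suc k"] by simp
    next
      fix i j k assume "i < j \<and> j < k \<and> k < length w"
      then show "\<not> T (w ! i) (w ! j) (w ! k)"
        using L[rule_format, of "Suc i" "Suc j" "Suc k"] by simp
    qed
  next
    assume R: ?R
    show ?L
    proof (intro allI impI)
      fix i j k assume h: "i < j \<and> j < k \<and> k < length (x # w)"
      then obtain j' k' where "j = Suc j'" "k = Suc k'" by (metis gr0_conv_Suc not_less0 neq0_conv)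
      then show "\<not> T ((x # w) ! i) ((x # w) ! j) ((x # w) ! k)"
        using R h by (cases i) auto
    qed
  qed
  then show ?case using Cons.IH by (auto simp: sorted_wrt_iff_nth_less)
qed simp

lemma sorted_wrtI:
  assumes "\<And>x y. x \<in> set xs \<Longrightarrow> y \<in> set xs \<Longrightarrow> P x y"
  shows "sorted_wrt P xs"
  using assms by (induction xs) auto

lemma triple_free_map:
  "triple_free T (map f w) \<longleftrightarrow> triple_free (\<lambda>x y z. T (f x) (f y) (f z)) w"
  by (induction w) (auto simp: sorted_wrt_map)

lemma triple_free_snoc:
  "triple_free T (w @ [z]) \<longleftrightarrow> triple_free T w \<and> sorted_wrt (\<lambda>x y. \<not> T x y z) w"
  by (induction w) (auto simp: sorted_wrt_append)

definition Av :: "(nat \<Rightarrow> nat \<Rightarrow> nat \<Rightarrow> bool) \<Rightarrow> nat \<Rightarrow> nat list set" where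
  "Av T n = {w. distinct w \<and> set w = {1..n} \<and> triple_free T w}"

lemma Av_length: "w \<in> Av T n \<Longrightarrow> length w = n"
  unfolding Av_def using distinct_card by fastforce

lemma finite_Av: "finite (Av T n)"
  by (rule finite_subset[OF _ finite_permutations_of_set[of "{1..n}"]])
     (auto simp: Av_def permutations_of_set_def)

lemma contains_pattern_length_3:
  "contains_pattern w [a, b, c] \<longleftrightarrow>
     (\<exists>i j k. i < j \<and> j < k \<and> k < length w \<and>
        (w ! i < w ! j \<longleftrightarrow> a < b) \<and> (w ! i < w ! k \<longleftrightarrow> a < c) \<and> (w ! j < w ! k \<longleftrightarrow> b < c))"
  (is "?L \<longleftrightarrow> ?R")
proof
  assume ?L
  then obtain f :: "nat \<Rightarrow> nat" where f: "strict_mono_on {..<3} f" "\<forall>a<3. f a < length w"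
    "\<And>x y. x < y \<Longrightarrow> y < 3 \<Longrightarrow> (w ! f x < w ! f y \<longleftrightarrow> [a, b, c] ! x < [a, b, c] ! y)"
    unfolding contains_pattern_def by (auto simp: numeral_3_eq_3)
  have "f 0 < f 1" "f 1 < f 2" using f(1) by (auto simp: strict_mono_on_def)
  moreover have "f 2 < length w" using f(2) by simp
  moreover note f(3)[of 0 1] f(3)[of 0 2] f(3)[of 1 2]
  ultimately show ?R by (intro exI[of _ "f 0"] exI[of _ "f 1"] exI[of _ "f 2"]) simp
next
  assume ?R
  then obtain i j k where h: "i < j" "j < k" "k < length w"
    "w ! i < w ! j \<longleftrightarrow> a < b" "w ! i < w ! k \<longleftrightarrow> a < c" "w ! j < w ! k \<longleftrightarrow> b < c" by blast
  have pairs: "\<forall>x y. x < y \<and> y < 3 \<longrightarrow> Q x y" if "Q 0 1" "Q 0 2" "Q 1 2"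
    for Q :: "nat \<Rightarrow> nat \<Rightarrow> bool"
  proof (intro allI impI)
    fix x y :: nat assume "x < y \<and> y < 3"
    then have "x = 0 \<and> y = 1 \<or> x = 0 \<and> y = 2 \<or> x = 1 \<and> y = 2" by auto
    then show "Q x y" using that by blast
  qed
  have "\<forall>x y. x < y \<and> y < 3 \<longrightarrow> [i, j, k] ! x < [i, j, k] ! y"
    by (rule pairs) (use h(1,2) in simp_all)
  then have "strict_mono_on {..<3} ((!) [i, j, k])"
    by (simp add: strict_mono_on_def)
  moreover have "\<forall>a<3. [i, j, k] ! a < length w"
    using h(1-3) by (simp add: numeral_3_eq_3 All_less_Suc)
  moreover have "\<forall>x y. x < y \<and> y < 3 \<longrightarrow>
      (w ! ([i, j, k] ! x) < w ! ([i, j, k] ! y) \<longleftrightarrow> [a, b, c] ! x < [a, b, c] ! y)"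
    by (rule pairs) (use h(4-6) in simp_all)
  ultimately show ?L unfolding contains_pattern_def
    by (intro exI[of _ "(!) [i, j, k]"]) (simp add: numeral_3_eq_3)
qed

text \<open>
  The entries of a permutation are distinct, so \<open>T\<close> has to agree with the disjunction of the two
  patterns on triples of distinct values only. This leaves room for a short relation \<open>T\<close>.
\<close>
lemma avoiders_eq_Av:
  assumes "\<And>x y z. x \<noteq> y \<Longrightarrow> x \<noteq> z \<Longrightarrow> y \<noteq> z \<Longrightarrow>
     T x y z \<longleftrightarrow> ((x < y \<longleftrightarrow> a < b) \<and> (x < z \<longleftrightarrow> a < c) \<and> (y < z \<longleftrightarrow> b < c)) \<or>
                 ((x < y \<longleftrightarrow> a' < b') \<and> (x < z \<longleftrightarrow> a' < c') \<and> (y < z \<longleftrightarrow> b' < c'))"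
  shows "avoiders {[a, b, c], [a', b', c']} n = Av T n"
proof -
  have "(\<forall>s\<in>{[a, b, c], [a', b', c']}. \<not> contains_pattern w s) \<longleftrightarrow> triple_free T w"
    if "distinct w" for w
  proof -
    have "T (w ! i) (w ! j) (w ! k) \<longleftrightarrow>
        ((w ! i < w ! j \<longleftrightarrow> a < b) \<and> (w ! i < w ! k \<longleftrightarrow> a < c) \<and> (w ! j < w ! k \<longleftrightarrow> b < c)) \<or>
        ((w ! i < w ! j \<longleftrightarrow> a' < b') \<and> (w ! i < w ! k \<longleftrightarrow> a' < c') \<and> (w ! j < w ! k \<longleftrightarrow> b' < c'))"
      if "i < j" "j < k" "k < length w" for i j k
      using that \<open>distinct w\<close> by (intro assms) (auto simp: nth_eq_iff_index_eq)
    then show ?thesis unfolding triple_free_iff_nth ball_simps contains_pattern_length_3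
      by blast
  qed
  then show ?thesis unfolding avoiders_def Av_def permutations_of_set_def by auto
qed

section \<open>The statistics under adding a first entry\<close>

lemma finite_DES: "finite (DES w)"
  unfolding DES_def by simp

lemma Suc_mem_DES_Cons:
  "Suc i \<in> DES (x # w) \<longleftrightarrow> i \<in> DES w \<or> (i = 0 \<and> w \<noteq> [] \<and> hd w < x)"
  unfolding DES_def by (cases w; cases i) auto

lemma DES_Cons:
  "DES (x # w) = (if w \<noteq> [] \<and> hd w < x then insert 1 (Suc ` DES w) else Suc ` DES w)"
proof -
  have 0: "0 \<notin> DES v" for v unfolding DES_def by simp
  have "i \<in> DES (x # w) \<longleftrightarrow>
      i \<in> (if w \<noteq> [] \<and> hd w < x then insert 1 (Suc ` DES w) else Suc ` DES w)" for i
    using 0 Suc_mem_DES_Cons[of _ x w] by (cases i) auto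
  then show ?thesis by blast
qed

lemma des_Nil [simp]: "des [] = 0" and iar_Nil [simp]: "iar [] = 0"
  by (simp_all add: des_def iar_def DES_def)

lemma des_Cons: "des (x # w) = des w + (if w \<noteq> [] \<and> hd w < x then 1 else 0)"
proof -
  have "1 \<notin> Suc ` DES w" by (auto simp: DES_def)
  then show ?thesis
    by (simp add: des_def DES_Cons finite_DES card_image)
qed

lemma iar_Cons: "iar (x # w) = (if w \<noteq> [] \<and> hd w < x then 1 else Suc (iar w))"
proof (cases "w \<noteq> [] \<and> hd w < x")
  case True
  then show ?thesis unfolding iar_def
    by (intro Min_eqI) (auto simp: DES_Cons finite_DES)
next
  case False
  have "DES (x # w) \<union> {length (x # w)} = Suc ` (DES w \<union> {length w})"
    using False by (auto simp: DES_Cons)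
  moreover have "Min (Suc ` (DES w \<union> {length w})) = Suc (iar w)"
    unfolding iar_def by (rule mono_Min_commute[symmetric]) (auto simp: finite_DES mono_def)
  ultimately show ?thesis using False by (auto simp: iar_def)
qed

lemma DES_map_strict_mono:
  assumes "\<And>x y. x \<in> set w \<Longrightarrow> y \<in> set w \<Longrightarrow> f x < f y \<longleftrightarrow> x < (y :: nat)"
  shows "DES (map f w) = DES w"
  unfolding DES_def using assms by (auto simp: less_imp_diff_less)

lemma des_map_Suc [simp]: "des (map Suc w) = des w"
  and iar_map_Suc [simp]: "iar (map Suc w) = iar w"
  unfolding des_def iar_def by (simp_all add: DES_map_strict_mono)

text \<open>
  The ends of the components. Written with \<open>take\<close>, the condition commutes with \<open>map\<close> and with adding
  a first entry.
\<close>
definition cuts :: "nat list \<Rightarrow> nat set" where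
  "cuts w = {i \<in> {1..length w}. \<forall>x\<in>set (take i w). x \<le> i}"

lemma finite_cuts: "finite (cuts w)"
  by (simp add: cuts_def)

lemma comp_eq_card_cuts: "comp w = card (cuts w)"
proof -
  have "(\<forall>j\<in>{1..i}. w ! (j - 1) \<le> i) \<longleftrightarrow> (\<forall>x\<in>set (take i w). x \<le> i)"
    if "i \<le> length w" for i
  proof -
    have "set (take i w) = (!) w ` {..<i}"
      using nth_image[OF that] by (simp add: lessThan_atLeast0)
    also have "{..<i} = (\<lambda>j. j - 1) ` {1..i}"
      by (force simp: image_iff intro: bexI[of _ "Suc _"])
    finally show ?thesis by (auto simp: image_iff)
  qed
  then have "{i \<in> {1..length w}. \<forall>j\<in>{1..i}. w ! (j - 1) \<le> i} = cuts w"
    unfolding cuts_def by auto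
  then show ?thesis unfolding comp_def by simp
qed

lemma comp_eqI:
  assumes "\<And>k. Suc k \<in> cuts v \<longleftrightarrow> k \<in> cuts w"
  shows "comp v = comp w"
proof -
  have "i \<in> cuts v \<longleftrightarrow> i \<in> Suc ` cuts w" for i
    using assms by (cases i) (auto simp: cuts_def)
  then have "cuts v = Suc ` cuts w" by blast
  then show ?thesis by (simp add: comp_eq_card_cuts card_image)
qed

section \<open>Splitting off the permutations that start with 1\<close>

definition weight :: "'a \<Rightarrow> 'a \<Rightarrow> 'a \<Rightarrow> nat list \<Rightarrow> 'a :: comm_semiring_1" where
  "weight t r p w = t ^ des w * r ^ iar w * p ^ comp w"

definition prepend_one :: "nat list \<Rightarrow> nat list" where
  "prepend_one w = 1 # map Suc w"

lemma comp_prepend_one: "comp (prepend_one w) = Suc (comp w)"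
proof -
  have "i \<in> cuts (prepend_one w) \<longleftrightarrow> i \<in> insert 1 (Suc ` cuts w)" for i
  proof (cases i)
    case (Suc k)
    then show ?thesis
      by (cases k) (auto simp: cuts_def prepend_one_def take_map)
  qed (auto simp: cuts_def)
  then have "cuts (prepend_one w) = insert 1 (Suc ` cuts w)" by blast
  moreover have "1 \<notin> Suc ` cuts w" by (auto simp: cuts_def)
  ultimately show ?thesis
    by (simp add: comp_eq_card_cuts card_image finite_cuts)
qed

lemma weight_prepend_one: "weight t r p (prepend_one w) = r * p * weight t r p w"
  unfolding weight_def comp_prepend_one
  by (cases "w = []") (simp_all add: prepend_one_def des_Cons iar_Cons algebra_simps hd_map)

lemma inj_prepend_one: "inj prepend_one"
  by (rule injI) (simp add: prepend_one_def)

text \<open>Deleting the entry 1 of a permutation leaves a shifted permutation.\<close>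
lemma obtain_map_Suc:
  assumes "distinct xs" "1 \<notin> set xs" "insert 1 (set xs) = {1..Suc n}"
  obtains v where "xs = map Suc v" "distinct v" "set v = {1..n}"
proof
  have "set xs = {1..Suc n} - {1}"
    by (rule Diff_insert_absorb[OF assms(2), unfolded assms(3), symmetric])
  also have "\<dots> = {2..Suc n}" by auto
  finally have set_xs: "set xs = {2..Suc n}" .
  show 1: "xs = map Suc (map (\<lambda>x. x - 1) xs)"
    by (auto simp: set_xs o_def intro!: map_idI[symmetric])
  show "distinct (map (\<lambda>x. x - 1) xs)"
    by (metis 1 assms(1) distinct_map)
  have "Suc ` set (map (\<lambda>x. x - 1) xs) = Suc ` {1..n}"
    by (metis 1 set_xs image_Suc_atLeastAtMost numeral_2_eq_2 One_nat_def list.set_map)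
  then show "set (map (\<lambda>x. x - 1) xs) = {1..n}"
    using inj_image_eq_iff[OF inj_Suc] by blast
qed

lemma insert_1_Suc_image: "insert 1 (Suc ` {1..n}) = {1..Suc n}"
  by (metis One_nat_def image_Suc_atLeastAtMost atLeastAtMost_insertL le_add1 plus_1_eq_Suc)

text \<open>
  The recursion needs two properties of the forbidden relation: it is invariant under shifting all
  values, and an entry below two later ones never takes part in it as the first entry. The latter
  makes every class closed under prepending a new minimum.
\<close>
locale order_triple =
  fixes T :: "nat \<Rightarrow> nat \<Rightarrow> nat \<Rightarrow> bool"
  assumes T_Suc [simp]: "T (Suc x) (Suc y) (Suc z) \<longleftrightarrow> T x y z"
    and T_small [simp]: "\<lbrakk>x < y; x < z\<rbrakk> \<Longrightarrow> \<not> T x y z"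
begin

lemma triple_free_map_Suc [simp]: "triple_free T (map Suc w) \<longleftrightarrow> triple_free T w"
  by (simp add: triple_free_map)

lemma prepend_one_mem_Av:
  assumes "w \<in> Av T n"
  shows "prepend_one w \<in> Av T (Suc n)"
proof -
  have "set w = {1..n}" using assms by (simp add: Av_def)
  then have "insert 1 (Suc ` set w) = {1..Suc n}" by (simp only: insert_1_Suc_image)
  moreover have "sorted_wrt (\<lambda>y z. \<not> T (Suc 0) y z) (map Suc w)"
    using \<open>set w = {1..n}\<close> by (intro sorted_wrtI T_small) auto
  ultimately show ?thesis
    using assms by (auto simp: Av_def prepend_one_def distinct_map)
qed

lemma Av_Suc_hd_1:
  assumes "w \<in> Av T (Suc n)" "hd w = 1"
  shows "w \<in> prepend_one ` Av T n"
proof -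
  obtain xs where w: "w = 1 # xs"
    using assms by (cases w) (auto simp: Av_def)
  have "distinct xs" "1 \<notin> set xs" "insert 1 (set xs) = {1..Suc n}"
    using assms(1) by (simp_all add: Av_def w)
  then obtain v where "xs = map Suc v" "distinct v" "set v = {1..n}"
    by (rule obtain_map_Suc)
  then show ?thesis
    using assms(1) by (auto simp: Av_def w prepend_one_def image_iff)
qed

lemma Av_0: "Av T 0 = {[]}"
  by (auto simp: Av_def)

lemma Av_1: "Av T (Suc 0) = {[1]}"
proof
  show "Av T (Suc 0) \<subseteq> {[1]}"
  proof
    fix w assume w: "w \<in> Av T (Suc 0)"
    then have "length w = 1" by (simp add: Av_length)
    then obtain x where "w = [x]" by (metis One_nat_def length_0_conv length_Suc_conv)
    then show "w \<in> {[1]}" using w by (simp add: Av_def)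
  qed
qed (simp add: Av_def)

text \<open>
  The common shape of the three recursions: if \<open>f\<close> produces the words of the class that do not start
  with 1, each exactly once, then any sum over the class splits accordingly.
\<close>
lemma sum_Av_split:
  assumes inj: "inj_on f (Av T (Suc n))"
    and mem: "\<And>w. w \<in> Av T (Suc n) \<Longrightarrow> f w \<in> Av T (Suc (Suc n)) \<and> hd (f w) \<noteq> 1"
    and surj: "\<And>w. w \<in> Av T (Suc (Suc n)) \<Longrightarrow> hd w \<noteq> 1 \<Longrightarrow> w \<in> f ` Av T (Suc n)"
  shows "sum g (Av T (Suc (Suc n))) =
     (\<Sum>w\<in>Av T (Suc n). g (prepend_one w)) + (\<Sum>w\<in>Av T (Suc n). g (f w))"
proof -
  have eq: "Av T (Suc (Suc n)) = prepend_one ` Av T (Suc n) \<union> f ` Av T (Suc n)"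
  proof (intro equalityI subsetI)
    fix w assume "w \<in> Av T (Suc (Suc n))"
    then show "w \<in> prepend_one ` Av T (Suc n) \<union> f ` Av T (Suc n)"
      using surj Av_Suc_hd_1 by (cases "hd w = 1") auto
  next
    fix w assume "w \<in> prepend_one ` Av T (Suc n) \<union> f ` Av T (Suc n)"
    then show "w \<in> Av T (Suc (Suc n))"
      using mem prepend_one_mem_Av by auto
  qed
  have "hd v = 1" if "v \<in> prepend_one ` Av T (Suc n)" for v
    using that by (auto simp: prepend_one_def)
  moreover have "hd v \<noteq> 1" if "v \<in> f ` Av T (Suc n)" for v
    using that mem by blast
  ultimately have disj: "prepend_one ` Av T (Suc n) \<inter> f ` Av T (Suc n) = {}"
    by blast
  have "inj_on prepend_one (Av T (Suc n))"
    using inj_prepend_one by (rule inj_on_subset) simp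
  then have "sum g (prepend_one ` Av T (Suc n)) = (\<Sum>w\<in>Av T (Suc n). g (prepend_one w))"
    by (simp add: sum.reindex)
  moreover have "sum g (f ` Av T (Suc n)) = (\<Sum>w\<in>Av T (Suc n). g (f w))"
    using inj by (simp add: sum.reindex)
  moreover have "sum g (Av T (Suc (Suc n))) =
      sum g (prepend_one ` Av T (Suc n)) + sum g (f ` Av T (Suc n))"
    unfolding eq by (intro sum.union_disjoint finite_imageI finite_Av disj)
  ultimately show ?thesis by simp
qed

lemma weight_sum_0: "sum (weight t r p) (Av T 0) = 1"
  by (simp add: Av_0 weight_def comp_def)

lemma weight_sum_1: "sum (weight t r p) (Av T (Suc 0)) = r * p"
proof -
  have "Av T (Suc 0) = {prepend_one []}" by (simp add: Av_1 prepend_one_def)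
  moreover have "weight t r p [] = 1" by (simp add: weight_def comp_def)
  ultimately show ?thesis by (simp add: weight_prepend_one)
qed

end


lemma Av_SucE:
  assumes "w \<in> Av T (Suc n)"
  obtains x u where "w = x # u" "1 \<le> x" "x \<le> Suc n" "x \<notin> set u" "distinct u"
    "insert x (set u) = {1..Suc n}" "\<And>y. y \<in> set u \<Longrightarrow> 1 \<le> y"
    "sorted_wrt (\<lambda>y z. \<not> T x y z) u" "triple_free T u"
proof (cases w)
  case Nil
  then show ?thesis using assms by (simp add: Av_def)
next
  case (Cons x u)
  have set_w: "insert x (set u) = {1..Suc n}" and "x \<notin> set u" "distinct u"
    "sorted_wrt (\<lambda>y z. \<not> T x y z) u" "triple_free T u"
    using assms by (simp_all add: Av_def Cons)
  moreover have "y \<in> {1..Suc n}" if "y \<in> insert x (set u)" for y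
    using that unfolding set_w .
  then have "1 \<le> x" "x \<le> Suc n" "\<And>y. y \<in> set u \<Longrightarrow> 1 \<le> y" by simp_all
  ultimately show ?thesis by (intro that[OF Cons])
qed

section \<open>From the recursion to the generating function\<close>

text \<open>The coefficients of the rational series \<open>1 / (1 - u z + v z\<^sup>2)\<close>.\<close>
fun gf_coeff :: "'a \<Rightarrow> 'a \<Rightarrow> nat \<Rightarrow> 'a :: comm_ring_1" where
  "gf_coeff u v 0 = 1"
| "gf_coeff u v (Suc 0) = u"
| "gf_coeff u v (Suc (Suc n)) = u * gf_coeff u v (Suc n) - v * gf_coeff u v n"

lemma gf_coeff_0: "gf_coeff u 0 n = u ^ n"
  by (induction u "0 :: 'a" n rule: gf_coeff.induct) simp_all

lemma Abs_fps_gf_coeff: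
  "Abs_fps (gf_coeff u v) * (1 - fps_const u * fps_X + fps_const v * fps_X ^ 2) = 1"
proof (rule fps_ext)
  fix n
  let ?E = "Abs_fps (gf_coeff u v)"
  have "?E * (1 - fps_const u * fps_X + fps_const v * fps_X ^ 2) =
      ?E - fps_const u * (fps_X * ?E) + fps_const v * (fps_X * (fps_X * ?E))"
    by (simp add: algebra_simps power2_eq_square)
  also have "fps_nth \<dots> n = fps_nth 1 n"
  proof -
    consider "n = 0" | "n = Suc 0" | m where "n = Suc (Suc m)" by (metis not0_implies_Suc)
    then show ?thesis by cases simp_all
  qed
  finally show "fps_nth (?E * (1 - fps_const u * fps_X + fps_const v * fps_X ^ 2)) n =
      fps_nth 1 n" .
qed

text \<open>
  Write \<open>A\<close> for the generating function, \<open>E\<close> for the inverse of \<open>D = 1 - u z + v z\<^sup>2\<close>, and put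
  \<open>G = 1 - r p z\<close> and \<open>K = r p z\<close>. The recursion reads \<open>A * G = 1 + K * t z E\<close>, so
  \<open>(A - 1) * G = K * (1 + t z E)\<close>, and multiplying by \<open>D\<close> turns the bracket into \<open>D + t z\<close>. As \<open>G * D\<close>
  has constant term 1, it is a unit, and the factor \<open>K\<close> cancels.
\<close>
lemma perm_gf_tilde_eq:
  fixes t r p u v :: "'a :: field"
  assumes "r \<noteq> 0" "p \<noteq> 0" and T: "order_triple T" and av: "\<And>n. avoiders P n = Av T n"
    and rec: "\<And>n. sum (weight t r p) (Av T (Suc (Suc n))) =
      r * p * sum (weight t r p) (Av T (Suc n)) + r * t * p * gf_coeff u v n"
  shows "perm_gf_tilde P t r p =
    (1 - fps_const (u - t) * fps_X + fps_const v * fps_X ^ 2) /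
    ((1 - fps_const (r * p) * fps_X) * (1 - fps_const u * fps_X + fps_const v * fps_X ^ 2))"
proof -
  interpret order_triple T by (fact T)
  define A where "A = perm_gf P t r p"
  define E where "E = Abs_fps (gf_coeff u v)"
  define D where "D = 1 - fps_const u * fps_X + fps_const v * fps_X ^ 2"
  define G where "G = 1 - fps_const (r * p) * fps_X"
  define K where "K = fps_const r * fps_const p * fps_X"
  have nth_A: "fps_nth A n = sum (weight t r p) (Av T n)" for n
    by (simp add: A_def perm_gf_def weight_def av)
  have ED: "E * D = 1" unfolding E_def D_def by (rule Abs_fps_gf_coeff)
  have "A = 1 + fps_const (r * p) * (fps_X * A) + fps_const (r * t * p) * (fps_X * (fps_X * E))"
  proof (rule fps_ext)
    fix n
    consider "n = 0" | "n = Suc 0" | m where "n = Suc (Suc m)" by (metis not0_implies_Suc)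
    then show "fps_nth A n = fps_nth (1 + fps_const (r * p) * (fps_X * A) +
        fps_const (r * t * p) * (fps_X * (fps_X * E))) n"
      by cases (simp_all add: nth_A weight_sum_0 weight_sum_1 rec E_def)
  qed
  then have "A * G = 1 + K * (fps_const t * fps_X * E)"
    unfolding G_def K_def
    by (simp add: algebra_simps flip: fps_const_mult)
  then have "(A - 1) * G = K * (1 + fps_const t * fps_X * E)"
    unfolding G_def K_def by (simp add: algebra_simps flip: fps_const_mult)
  then have "(A - 1) * (G * D) = K * (D + fps_const t * fps_X * (E * D))"
    by (simp add: algebra_simps)
  also have "D + fps_const t * fps_X * (E * D) =
      1 - fps_const (u - t) * fps_X + fps_const v * fps_X ^ 2" (is "_ = ?N")
    unfolding ED unfolding D_def by (simp add: algebra_simps flip: fps_const_sub)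
  finally have main: "(A - 1) * (G * D) = K * ?N" .
  have unit: "fps_nth (G * D) 0 \<noteq> 0" by (simp add: G_def D_def)
  have "A - 1 = (A - 1) * (G * D) * inverse (G * D)"
    by (simp only: mult.assoc[of "A - 1"] inverse_mult_eq_1'[OF unit] mult_1_right)
  also have "\<dots> = K * (?N * inverse (G * D))"
    unfolding main by (simp add: mult.assoc)
  also have "\<dots> = K * (?N / (G * D))"
    using unit by (simp add: fps_divide_unit)
  finally have "A - 1 = K * (?N / (G * D))" .
  moreover have "K \<noteq> 0" using assms(1,2) by (simp add: K_def)
  ultimately have "(A - 1) / K = ?N / (G * D)" by simp
  then show ?thesis unfolding perm_gf_tilde_def A_def K_def G_def D_def .
qed

section \<open>Avoiding 213 and 312: unimodal permutations\<close>

definition valley :: "nat \<Rightarrow> nat \<Rightarrow> nat \<Rightarrow> bool" where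
  "valley x y z \<longleftrightarrow> y < x \<and> y < z"

interpretation valley: order_triple valley
  by unfold_locales (auto simp: valley_def)

lemma avoiders_213_312: "avoiders {[2, 1, 3], [3, 1, 2]} n = Av valley n"
  by (rule avoiders_eq_Av) (auto simp: valley_def)

definition append_one :: "nat list \<Rightarrow> nat list" where
  "append_one w = map Suc w @ [1]"

text \<open>
  The appended 1 creates a descent at position \<open>length w\<close>, which \<open>iar w\<close> does not exceed anyway. A proper prefix of the new word misses the value 1, so
  it cannot consist of its \<open>i\<close> smallest values: there is a single component, and \<open>p\<close> survives only
  as one factor.
\<close>
lemma weight_append_one:
  assumes "w \<in> Av T (Suc n)"
  shows "weight t r p (append_one w) = t * p * weight t r 1 w"
proof -
  have len: "length w = Suc n" and pos: "\<And>x. x \<in> set w \<Longrightarrow> 1 \<le> x"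
    and dist: "distinct w"
    using assms by (auto simp: Av_length) (auto simp: Av_def)
  have "i \<in> DES (append_one w) \<longleftrightarrow> i \<in> insert (length w) (DES w)" for i
  proof -
    consider "i < length w" | "i = length w" | "i > length w" by linarith
    then show ?thesis
    proof cases
      case 1
      then show ?thesis by (auto simp: DES_def append_one_def nth_append)
    next
      case 2
      moreover have "w ! n \<ge> 1" using pos len by auto
      ultimately show ?thesis using len by (auto simp: DES_def append_one_def nth_append)
    qed (auto simp: DES_def append_one_def)
  qed
  then have DES: "DES (append_one w) = insert (length w) (DES w)" by blast
  have "length w \<notin> DES w" by (simp add: DES_def)
  then have des: "des (append_one w) = Suc (des w)"
    by (simp add: des_def DES finite_DES)
  have "iar (append_one w) = Min (insert (Suc (length w)) (DES w \<union> {length w}))"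
    by (simp add: iar_def DES insert_commute) (simp add: append_one_def)
  also have "\<dots> = iar w"
    by (subst Min_insert) (auto simp: iar_def finite_DES min_def Min_le_iff)
  finally have iar: "iar (append_one w) = iar w" .
  have "i \<in> cuts (append_one w) \<longleftrightarrow> i = Suc (length w)" for i
  proof
    assume i: "i \<in> cuts (append_one w)"
    show "i = Suc (length w)"
    proof (rule ccontr)
      assume "i \<noteq> Suc (length w)"
      with i have le: "1 \<le> i" "i \<le> length w"
        by (auto simp: cuts_def append_one_def)
      have "x \<in> {1..i - 1}" if x: "x \<in> set (take i w)" for x
      proof -
        have "Suc x \<in> set (take i (append_one w))"
          using x le by (simp add: append_one_def take_map)
        then have "Suc x \<le> i" using i unfolding cuts_def by blast
        then show ?thesis using pos[OF in_set_takeD[OF x]] by simp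
      qed
      \<comment> \<open>A cut at \<open>i\<close> would leave only \<open>i - 1\<close> values for \<open>i\<close> distinct entries.\<close>
      then have "card (set (take i w)) \<le> card {1..i - 1}"
        by (intro card_mono) auto
      also have "card (set (take i w)) = i"
        using dist le by (simp add: distinct_card)
      finally show False using le by simp
    qed
  next
    have "x \<le> Suc n" if "x \<in> set w" for x
      using assms that by (auto simp: Av_def)
    then show "i \<in> cuts (append_one w)" if "i = Suc (length w)"
      using that len by (auto simp: cuts_def append_one_def)
  qed
  then have "cuts (append_one w) = {Suc (length w)}" by blast
  then have "comp (append_one w) = 1" by (simp add: comp_eq_card_cuts)
  then show ?thesis by (simp add: weight_def des iar algebra_simps)
qed

lemma append_one_mem_Av:
  assumes "w \<in> Av valley (Suc n)"
  shows "append_one w \<in> Av valley (Suc (Suc n)) \<and> hd (append_one w) \<noteq> 1"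
proof
  have w: "set w = {1..Suc n}" "w \<noteq> []" using assms by (auto simp: Av_def)
  then show "hd (append_one w) \<noteq> 1"
    using hd_in_set[of w] by (auto simp: append_one_def hd_append hd_map)
  have "sorted_wrt (\<lambda>x y. \<not> valley x y 1) (map Suc w)"
    by (rule sorted_wrtI) (auto simp: valley_def)
  moreover have "set (append_one w) = {1..Suc (Suc n)}"
    unfolding insert_1_Suc_image[symmetric] using w by (auto simp: append_one_def)
  ultimately show "append_one w \<in> Av valley (Suc (Suc n))"
    using assms by (auto simp: Av_def append_one_def distinct_map triple_free_snoc)
qed

text \<open>An entry 1 with neighbours on both sides would be the bottom of a valley.\<close>
lemma append_one_surj:
  assumes w: "w \<in> Av valley (Suc (Suc n))" "hd w \<noteq> 1"
  shows "w \<in> append_one ` Av valley (Suc n)"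
proof -
  have "1 \<in> set w" using w by (auto simp: Av_def)
  then obtain us vs where eq: "w = us @ 1 # vs" by (meson split_list)
  obtain a us' where us: "us = a # us'" using w(2) eq by (cases us) auto
  have "vs = []"
  proof (cases vs)
    case (Cons b vs')
    have set_w: "set w = {1..Suc (Suc n)}" and "distinct w" using w by (auto simp: Av_def)
    have "{a, b} \<subseteq> set w" by (simp add: eq us Cons)
    moreover have "a \<noteq> 1" "b \<noteq> 1" using \<open>distinct w\<close> by (auto simp: eq us Cons)
    ultimately have "a > 1" "b > 1" unfolding set_w by auto
    moreover have "\<not> valley a 1 b"
      using w(1) by (simp add: Av_def eq us Cons sorted_wrt_append)
    ultimately show ?thesis by (simp add: valley_def)
  qed
  then have w_eq: "w = us @ [1]" using eq by simp
  have "distinct us" "1 \<notin> set us" "insert 1 (set us) = {1..Suc (Suc n)}"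
    using w(1) by (simp_all add: Av_def w_eq)
  then obtain v where v: "us = map Suc v" "distinct v" "set v = {1..Suc n}"
    using obtain_map_Suc by metis
  then have "v \<in> Av valley (Suc n)"
    using w(1) by (auto simp: Av_def w_eq triple_free_snoc)
  then show ?thesis using v by (auto simp: w_eq append_one_def)
qed

lemma weight_sum_valley:
  "sum (weight t r p) (Av valley (Suc (Suc n))) =
     r * p * sum (weight t r p) (Av valley (Suc n)) + r * t * p * gf_coeff (r + t) 0 n"
proof -
  have step: "sum (weight t r p) (Av valley (Suc (Suc n))) =
     r * p * sum (weight t r p) (Av valley (Suc n)) +
     t * p * sum (weight t r 1) (Av valley (Suc n))" for p n
  proof -
    have "inj_on append_one (Av valley (Suc n))"
      by (rule inj_onI) (simp add: append_one_def)
    note split = valley.sum_Av_split[OF this append_one_mem_Av append_one_surj]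
    show ?thesis
      by (simp add: split weight_prepend_one weight_append_one sum_distrib_left)
  qed
  have "sum (weight t r 1) (Av valley (Suc n)) = r * (r + t) ^ n"
    by (induction n) (simp_all add: valley.weight_sum_1 step algebra_simps)
  then show ?thesis by (simp add: step gf_coeff_0 algebra_simps)
qed

section \<open>Avoiding 231 and 312: layered permutations\<close>

text \<open>
  The words 231 and 312 are the two three-cycles in the symmetric group on three letters. In both of
  them the first value lies between the other two.
\<close>
definition three_cycle :: "nat \<Rightarrow> nat \<Rightarrow> nat \<Rightarrow> bool" where
  "three_cycle x y z \<longleftrightarrow> (z < x \<and> x < y) \<or> (y < z \<and> z < x)"

interpretation three_cycle: order_triple three_cycle
  by unfold_locales (auto simp: three_cycle_def)

lemma avoiders_231_312: "avoiders {[2, 3, 1], [3, 1, 2]} n = Av three_cycle n"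
  by (rule avoiders_eq_Av) (auto simp: three_cycle_def)

text \<open>The increasing relabelling that frees the value \<open>d + 1\<close>.\<close>
definition make_room :: "nat \<Rightarrow> nat \<Rightarrow> nat" where
  "make_room d y = (if d < y then Suc y else y)"

text \<open>
  A layered permutation starts with \<open>d, d - 1, \<dots>, 1\<close>, where \<open>d\<close> is its first entry. Prepending
  \<open>d + 1\<close> lengthens this layer.
\<close>
definition extend_first_layer :: "nat list \<Rightarrow> nat list" where
  "extend_first_layer w = Suc (hd w) # map (make_room (hd w)) w"

lemma make_room_less_iff [simp]: "make_room d x < make_room d y \<longleftrightarrow> x < y"
  by (auto simp: make_room_def)

lemma three_cycle_make_room [simp]:
  "three_cycle (make_room d x) (make_room d y) (make_room d z) \<longleftrightarrow> three_cycle x y z"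
  by (simp add: three_cycle_def)

lemma inj_make_room: "inj (make_room d)"
  by (rule injI) (metis make_room_less_iff nat_neq_iff)

text \<open>
  The new entry \<open>d + 1\<close> behaves towards the other entries like \<open>d\<close>, and no value lies strictly between
  \<open>d\<close> and \<open>d + 1\<close>, so it takes part in a forbidden triple only if \<open>d\<close> does.
\<close>
lemma extend_first_layer_mem_Av:
  assumes "w \<in> Av three_cycle (Suc n)"
  shows "extend_first_layer w \<in> Av three_cycle (Suc (Suc n)) \<and> hd (extend_first_layer w) \<noteq> 1"
  using assms
proof (rule Av_SucE)
  fix d u
  assume h: "w = d # u" "1 \<le> d" "d \<le> Suc n" "d \<notin> set u"
    "insert d (set u) = {1..Suc n}" "sorted_wrt (\<lambda>y z. \<not> three_cycle d y z) u"
  have set_eq: "insert (Suc d) (make_room d ` {1..Suc n}) = {1..Suc (Suc n)}"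
  proof -
    have "y \<in> insert (Suc d) (make_room d ` {1..Suc n})" if "y \<in> {1..Suc (Suc n)}" for y
    proof -
      consider "y \<le> d" | "y = Suc d" | "y > Suc d" by linarith
      then show ?thesis
      proof cases
        case 1
        then have "y = make_room d y" by (simp add: make_room_def)
        then show ?thesis using that 1 h(3) by (intro insertI2 image_eqI) auto
      next
        case 3
        then have "y = make_room d (y - 1)" by (auto simp: make_room_def)
        then show ?thesis using that 3 by (intro insertI2 image_eqI) auto
      qed simp
    qed
    moreover have "insert (Suc d) (make_room d ` {1..Suc n}) \<subseteq> {1..Suc (Suc n)}"
      using h(2,3) by (auto simp: make_room_def)
    ultimately show ?thesis by blast
  qed
  have "sorted_wrt (\<lambda>y z. \<not> three_cycle (Suc d) (make_room d y) (make_room d z)) u"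
  proof (rule sorted_wrt_mono_rel[OF _ h(6)])
    fix y z assume "y \<in> set u" "z \<in> set u" and free: "\<not> three_cycle d y z"
    then have "y \<noteq> d" "z \<noteq> d" using h(4) by auto
    then show "\<not> three_cycle (Suc d) (make_room d y) (make_room d z)"
      using free by (auto simp: three_cycle_def make_room_def)
  qed
  then have "sorted_wrt (\<lambda>y z. \<not> three_cycle (Suc d) (make_room d y) (make_room d z)) w"
    by (auto simp: h(1) three_cycle_def make_room_def)
  then have "triple_free three_cycle (extend_first_layer w)"
    using assms by (auto simp: extend_first_layer_def h(1) Av_def triple_free_map sorted_wrt_map)
  moreover have "distinct (extend_first_layer w)"
  proof -
    have "Suc d \<noteq> make_room d y" for y by (auto simp: make_room_def)
    moreover have "distinct (map (make_room d) w)"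
      using assms inj_on_subset[OF inj_make_room] by (simp add: distinct_map Av_def)
    ultimately show ?thesis by (auto simp: extend_first_layer_def h(1))
  qed
  moreover have "set (extend_first_layer w) = {1..Suc (Suc n)}"
  proof -
    have "set (extend_first_layer w) = insert (Suc d) (make_room d ` set w)"
      by (simp add: extend_first_layer_def h(1))
    then show ?thesis using set_eq assms by (simp only: Av_def mem_Collect_eq)
  qed
  ultimately show ?thesis using h(2) by (simp add: Av_def extend_first_layer_def h(1))
qed

text \<open>
  If the first entry is \<open>x > 1\<close>, the second entry has to be \<open>x - 1\<close>: a smaller \<open>y\<close> gives the pattern
  312 with \<open>x, y, x - 1\<close>, and a larger \<open>y\<close> gives the pattern 231 with the same entries. So deleting
  \<open>x\<close> undoes the insertion.
\<close>
lemma extend_first_layer_surj: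
  assumes w: "w \<in> Av three_cycle (Suc (Suc n))" "hd w \<noteq> 1"
  shows "w \<in> extend_first_layer ` Av three_cycle (Suc n)"
  using w(1)
proof (rule Av_SucE)
  fix x u
  assume h: "w = x # u" "1 \<le> x" "x \<le> Suc (Suc n)" "x \<notin> set u" "distinct u"
    "insert x (set u) = {1..Suc (Suc n)}"
    "sorted_wrt (\<lambda>y z. \<not> three_cycle x y z) u" "triple_free three_cycle u"
  have x: "x \<ge> 2" using h(1,2) w(2) by simp
  define d where "d = x - 1"
  have set_u: "set u = {1..Suc (Suc n)} - {x}" using h(4,6) by blast
  have "d \<in> set u" using x h(3) by (auto simp: set_u d_def)
  then obtain y u' where u: "u = y # u'" by (cases u) auto
  have "y = d"
  proof (rule ccontr)
    assume "y \<noteq> d"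
    then have "\<not> three_cycle x y d" using h(7) \<open>d \<in> set u\<close> by (simp add: u)
    then show False
      using \<open>y \<noteq> d\<close> h(4) x by (auto simp: three_cycle_def d_def u)
  qed
  define v where "v = map (\<lambda>y. if y > x then y - 1 else y) u"
  have "make_room d (if y > x then y - 1 else y) = y" if "y \<in> set u" for y
    using that h(4) x by (cases "y = x") (auto simp: make_room_def d_def)
  then have u_eq: "u = map (make_room d) v"
    by (simp add: v_def o_def map_idI)
  have hd_v: "hd v = d" using x by (simp add: v_def u \<open>y = d\<close> d_def)
  have "set v = {1..Suc n}"
  proof -
    have "y \<in> set v" if "y \<in> {1..Suc n}" for y
    proof -
      have "make_room d y \<in> set u" using that x by (auto simp: set_u make_room_def d_def)
      then show ?thesis unfolding u_eq using inj_make_room by (simp add: inj_image_mem_iff)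
    qed
    moreover have "set v \<subseteq> {1..Suc n}" using x h(3) by (auto simp: v_def set_u)
    ultimately show ?thesis by blast
  qed
  moreover have "distinct v" using h(5) by (simp add: u_eq distinct_map)
  moreover have "triple_free three_cycle v"
    using h(8) by (simp add: u_eq triple_free_map)
  ultimately have "v \<in> Av three_cycle (Suc n)" by (simp add: Av_def)
  moreover have "w = extend_first_layer v"
    using x by (simp add: extend_first_layer_def hd_v h(1) u_eq[symmetric]) (simp add: d_def)
  ultimately show ?thesis by blast
qed

text \<open>
  The new word starts with a descent, so \<open>iar\<close> becomes 1 and the remaining weight is taken at
  \<open>r = 1\<close>. Every nonempty prefix of \<open>w\<close> contains \<open>d\<close>, so a cut of \<open>w\<close> is at least \<open>d\<close>. Therefore the cuts
  move up by one, although only the values above \<open>d\<close> do.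
\<close>
lemma weight_extend_first_layer:
  assumes "w \<in> Av three_cycle (Suc n)"
  shows "weight t r p (extend_first_layer w) = t * r * weight t 1 p w"
  using assms
proof (rule Av_SucE)
  fix d u assume w: "w = d # u" "1 \<le> d"
  have room_d: "make_room d d = d" by (simp add: make_room_def)
  have "des (map (make_room d) w) = des w"
    unfolding des_def by (simp add: DES_map_strict_mono)
  moreover have "des (extend_first_layer w) = Suc (des (map (make_room d) w))"
    unfolding extend_first_layer_def by (subst des_Cons) (simp add: w(1) room_d)
  moreover have "iar (extend_first_layer w) = 1"
    unfolding extend_first_layer_def by (subst iar_Cons) (simp add: w(1) room_d)
  moreover have "comp (extend_first_layer w) = comp w"
  proof (rule comp_eqI)
    fix k
    have "(\<forall>y\<in>set (take k w). make_room d y \<le> Suc k) \<and> d \<le> k \<longleftrightarrow> (\<forall>y\<in>set (take k w). y \<le> k)"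
      if "1 \<le> k"
    proof -
      have "d \<in> set (take k w)" using that by (cases k) (auto simp: w(1))
      moreover have "d \<le> k \<Longrightarrow> make_room d y \<le> Suc k \<longleftrightarrow> y \<le> k" for y
        by (auto simp: make_room_def)
      ultimately show ?thesis by blast
    qed
    moreover have "extend_first_layer w = Suc d # map (make_room d) w"
      by (simp add: extend_first_layer_def w(1))
    ultimately show "Suc k \<in> cuts (extend_first_layer w) \<longleftrightarrow> k \<in> cuts w"
      using w(2) by (cases "k = 0") (auto simp: cuts_def take_map)
  qed
  ultimately show ?thesis by (simp add: weight_def algebra_simps)
qed

lemma weight_sum_three_cycle:
  "sum (weight t r p) (Av three_cycle (Suc (Suc n))) =
     r * p * sum (weight t r p) (Av three_cycle (Suc n)) + r * t * p * gf_coeff (p + t) 0 n"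
proof -
  have step: "sum (weight t r p) (Av three_cycle (Suc (Suc n))) =
     r * p * sum (weight t r p) (Av three_cycle (Suc n)) +
     t * r * sum (weight t 1 p) (Av three_cycle (Suc n))" for r n
  proof -
    have "inj_on extend_first_layer (Av three_cycle (Suc n))"
      by (rule inj_onI)
         (auto simp: extend_first_layer_def dest: map_injective[OF _ inj_make_room])
    note split = three_cycle.sum_Av_split[OF this extend_first_layer_mem_Av extend_first_layer_surj]
    show ?thesis
      by (simp add: split weight_prepend_one weight_extend_first_layer sum_distrib_left)
  qed
  have "sum (weight t 1 p) (Av three_cycle (Suc n)) = p * (p + t) ^ n"
    by (induction n) (simp_all add: three_cycle.weight_sum_1 step algebra_simps)
  then show ?thesis by (simp add: step gf_coeff_0 algebra_simps)
qed

section \<open>Avoiding 231 and 321: direct sums of words \<open>m, 1, \<dots>, m - 1\<close>\<close>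

definition last_smallest :: "nat \<Rightarrow> nat \<Rightarrow> nat \<Rightarrow> bool" where
  "last_smallest x y z \<longleftrightarrow> z < x \<and> z < y"

interpretation last_smallest: order_triple last_smallest
  by unfold_locales (auto simp: last_smallest_def)

lemma avoiders_231_321: "avoiders {[2, 3, 1], [3, 2, 1]} n = Av last_smallest n"
  by (rule avoiders_eq_Av) (auto simp: last_smallest_def)

definition insert_one_second :: "nat list \<Rightarrow> nat list" where
  "insert_one_second w = Suc (hd w) # 1 # map Suc (tl w)"

lemma insert_one_second_mem_Av:
  assumes "w \<in> Av last_smallest (Suc n)"
  shows "insert_one_second w \<in> Av last_smallest (Suc (Suc n)) \<and> hd (insert_one_second w) \<noteq> 1"
  using assms
proof (rule Av_SucE)
  fix x u
  assume w: "w = x # u" "1 \<le> x" "\<And>y. y \<in> set u \<Longrightarrow> 1 \<le> y" "insert x (set u) = {1..Suc n}"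
    "sorted_wrt (\<lambda>y z. \<not> last_smallest x y z) u"
  have "sorted_wrt (\<lambda>y z. \<not> last_smallest (Suc 0) y z) (map Suc u)"
    by (rule sorted_wrtI) (auto simp: last_smallest_def)
  then have "triple_free last_smallest (insert_one_second w)"
    using assms w(2,5)
    by (auto simp: insert_one_second_def Av_def w(1) sorted_wrt_map) (auto simp: last_smallest_def)
  moreover have "set (insert_one_second w) = insert 1 (Suc ` insert x (set u))"
    by (simp add: insert_one_second_def w(1) insert_commute)
  then have "set (insert_one_second w) = {1..Suc (Suc n)}"
    by (simp only: w(4) insert_1_Suc_image)
  moreover have "distinct (insert_one_second w)"
    using assms w(2,3) by (force simp: insert_one_second_def Av_def w(1) distinct_map)
  ultimately show ?thesis using w(2) by (simp add: Av_def insert_one_second_def w(1))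
qed

text \<open>Two entries before the entry 1 would form a forbidden triple with it.\<close>
lemma insert_one_second_surj:
  assumes w: "w \<in> Av last_smallest (Suc (Suc n))" "hd w \<noteq> 1"
  shows "w \<in> insert_one_second ` Av last_smallest (Suc n)"
proof -
  have "1 \<in> set w" using w by (auto simp: Av_def)
  then obtain us vs where eq: "w = us @ 1 # vs" by (meson split_list)
  obtain a us' where us: "us = a # us'" using w(2) eq by (cases us) auto
  have set_w: "set w = {1..Suc (Suc n)}" "distinct w" using w by (auto simp: Av_def)
  have "us' = []"
  proof (cases us')
    case (Cons b us'')
    have "{a, b} \<subseteq> set w" by (simp add: eq us Cons)
    moreover have "a \<noteq> 1" "b \<noteq> 1" using set_w(2) by (auto simp: eq us Cons)
    ultimately have "a > 1" "b > 1" unfolding set_w(1) by auto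
    moreover have "\<not> last_smallest a b 1"
      using w(1) by (simp add: Av_def eq us Cons)
    ultimately show ?thesis by (simp add: last_smallest_def)
  qed
  then have w_eq: "w = a # 1 # vs" using eq us by simp
  have "distinct (a # vs)" "1 \<notin> set (a # vs)" "insert 1 (set (a # vs)) = {1..Suc (Suc n)}"
    using set_w by (auto simp: w_eq)
  then obtain v where v: "a # vs = map Suc v" "distinct v" "set v = {1..Suc n}"
    using obtain_map_Suc by metis
  then obtain x u where xu: "v = x # u" "a = Suc x" "vs = map Suc u" by auto
  then have "v \<in> Av last_smallest (Suc n)"
    using w(1) v by (auto simp: Av_def w_eq sorted_wrt_map)
  then show ?thesis by (auto simp: w_eq xu insert_one_second_def intro!: image_eqI[of _ _ v])
qed

lemma comp_insert_one_second:
  assumes "w \<noteq> []" "0 < hd w"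
  shows "comp (insert_one_second w) = comp w"
proof (rule comp_eqI)
  fix k
  obtain x u where "w = x # u" using assms by (cases w) auto
  then show "Suc k \<in> cuts (insert_one_second w) \<longleftrightarrow> k \<in> cuts w"
    using assms by (cases k) (auto simp: cuts_def insert_one_second_def take_map take_Cons' )
qed

lemma des_insert_one_second:
  "0 < hd w \<Longrightarrow> des (insert_one_second w) = Suc (des (tl w))"
  by (cases "tl w = []") (simp_all add: insert_one_second_def des_Cons hd_map)

lemma iar_insert_one_second: "0 < hd w \<Longrightarrow> iar (insert_one_second w) = 1"
  by (simp add: insert_one_second_def iar_Cons)

lemma weight_insert_one_second:
  "0 < hd w \<Longrightarrow> weight t r p (insert_one_second w) = r * weight t 1 p (insert_one_second w)"
  by (simp add: weight_def iar_insert_one_second algebra_simps)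

text \<open>
  The insertion deletes a descent at the first position, if there is one, and always creates a new
  one there. After \<open>prepend_one\<close> there was none, so a descent is gained; after an earlier insertion
  there was one, so the weight at \<open>r = 1\<close> does not change.
\<close>
lemma weight_insert_one_second_prepend_one:
  "weight t 1 p (insert_one_second (prepend_one w)) = t * p * weight t 1 p w"
proof -
  have "comp (insert_one_second (prepend_one w)) = Suc (comp w)"
    by (subst comp_insert_one_second) (simp_all add: comp_prepend_one, simp_all add: prepend_one_def)
  moreover have "des (insert_one_second (prepend_one w)) = Suc (des w)"
    by (subst des_insert_one_second) (simp_all add: prepend_one_def)
  ultimately show ?thesis by (simp add: weight_def algebra_simps)
qed

lemma weight_insert_one_second_twice:
  assumes "0 < hd w"
  shows "weight t 1 p (insert_one_second (insert_one_second w)) = weight t 1 p (insert_one_second w)"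
proof -
  have "0 < hd (insert_one_second w)" by (simp add: insert_one_second_def)
  note des = des_insert_one_second[OF this] des_insert_one_second[OF assms]
  have "comp (insert_one_second (insert_one_second w)) = comp (insert_one_second w)"
    by (rule comp_insert_one_second) (simp_all add: insert_one_second_def)
  moreover have "des (tl (insert_one_second w)) = des (tl w)"
    by (cases "tl w = []") (simp_all add: insert_one_second_def des_Cons hd_map)
  ultimately show ?thesis by (simp add: weight_def des)
qed

text \<open>
  Let \<open>b n\<close> be the weight at \<open>r = 1\<close> of the class of size \<open>n + 1\<close> and \<open>c n\<close> the weight of its image
  under the insertion. Splitting both sums by the first entry gives \<open>b (n + 1) = p * b n + c n\<close> and
  \<open>c (n + 1) = t * p * b n + c n\<close>. The solution is \<open>c n = t * p * e n\<close> and \<open>b n = e (n + 1) - e n\<close>, where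
  \<open>e\<close> has generating function \<open>1 / (1 - (p + 1) z + (1 - t) p z\<^sup>2)\<close>.
\<close>
lemma weight_sum_last_smallest:
  "sum (weight t r p) (Av last_smallest (Suc (Suc n))) =
     r * p * sum (weight t r p) (Av last_smallest (Suc n)) +
     r * t * p * gf_coeff (p + 1) ((1 - t) * p) n"
proof -
  let ?e = "gf_coeff (p + 1) ((1 - t) * p)"
  define b where "b n = sum (weight t 1 p) (Av last_smallest (Suc n))" for n
  define c where "c n = (\<Sum>w\<in>Av last_smallest (Suc n). weight t 1 p (insert_one_second w))" for n
  have hd_ge: "0 < hd w" if "w \<in> Av last_smallest (Suc n)" for w n
    using that by (rule Av_SucE) auto
  have split: "sum g (Av last_smallest (Suc (Suc n))) =
     (\<Sum>w\<in>Av last_smallest (Suc n). g (prepend_one w)) +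
     (\<Sum>w\<in>Av last_smallest (Suc n). g (insert_one_second w))" for g :: "nat list \<Rightarrow> 'a" and n
  proof -
    have "inj_on insert_one_second (Av last_smallest (Suc n))"
    proof (rule inj_onI)
      fix v w assume h: "v \<in> Av last_smallest (Suc n)" "w \<in> Av last_smallest (Suc n)"
        "insert_one_second v = insert_one_second w"
      then have "v \<noteq> []" "w \<noteq> []" by (auto simp: Av_def)
      then show "v = w" using h(3) by (auto simp: insert_one_second_def intro: list.expand)
    qed
    from last_smallest.sum_Av_split[OF this insert_one_second_mem_Av insert_one_second_surj]
    show ?thesis .
  qed
  have "c n = t * p * ?e n \<and> b n = ?e (Suc n) - ?e n"
  proof (induction n)
    case 0
    have "c 0 = weight t 1 p (insert_one_second (prepend_one []))"
      by (simp add: c_def last_smallest.Av_1 prepend_one_def)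
    also have "\<dots> = t * p * weight t 1 p []" by (rule weight_insert_one_second_prepend_one)
    also have "\<dots> = t * p" by (simp add: weight_def comp_def)
    finally show ?case by (simp add: b_def last_smallest.weight_sum_1)
  next
    case (Suc n)
    have "c (Suc n) = t * p * b n + c n"
      by (simp add: c_def b_def split weight_insert_one_second_prepend_one
        weight_insert_one_second_twice hd_ge sum_distrib_left)
    moreover have "b (Suc n) = p * b n + c n"
      by (simp add: c_def b_def split weight_prepend_one sum_distrib_left)
    ultimately show ?case using Suc.IH by (simp add: algebra_simps)
  qed
  moreover have "sum (weight t r p) (Av last_smallest (Suc (Suc n))) =
     r * p * sum (weight t r p) (Av last_smallest (Suc n)) + r * c n"
    by (simp add: split weight_prepend_one c_def sum_distrib_left
        weight_insert_one_second[of _ t r] hd_ge)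
  ultimately show ?thesis by (simp add: mult.assoc)
qed

theorem theorem4p6:
  fixes t r p :: "'a :: field"
  assumes "r \<noteq> 0" and "p \<noteq> 0"
  shows "perm_gf_tilde {[2,1,3], [3,1,2]} t r p =
           (1 - fps_const r * fps_X) /
           ((1 - fps_const (r * p) * fps_X) * (1 - fps_const (r + t) * fps_X))
         \<and>
         perm_gf_tilde {[2,3,1], [3,1,2]} t r p =
           (1 - fps_const p * fps_X) /
           ((1 - fps_const (r * p) * fps_X) * (1 - fps_const (p + t) * fps_X))
         \<and>
         perm_gf_tilde {[2,3,1], [3,2,1]} t r p =
           (1 - fps_const (1 + p - t) * fps_X + fps_const ((1 - t) * p) * fps_X ^ 2) /
           ((1 - fps_const (r * p) * fps_X) *
            (1 - fps_const (p + 1) * fps_X + fps_const ((1 - t) * p) * fps_X ^ 2))"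
  using
    perm_gf_tilde_eq[OF assms valley.order_triple_axioms avoiders_213_312 weight_sum_valley]
    perm_gf_tilde_eq[OF assms three_cycle.order_triple_axioms avoiders_231_312
      weight_sum_three_cycle]
    perm_gf_tilde_eq[OF assms last_smallest.order_triple_axioms avoiders_231_321
      weight_sum_last_smallest, of t]
  by (simp add: add.commute)

end
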